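(* The singular moduli $\alpha_{72}$ and $\alpha_{8/9}$ satisfy $$\alpha_{72}=\left(\sqrt{\frac{\sqrt{2}+2}{2}}-\sqrt{\frac{\sqrt{2}}{2}}\right)^{16}\left(\sqrt{\frac{3\sqrt{2}+6}{2}}-\sqrt{\frac{3\sqrt{2}+4}{2}}\right)^{8},$$ $$\alpha_{8/9}=\left(\sqrt{\frac{\sqrt{2}+2}{2}}-\sqrt{\frac{\sqrt{2}}{2}}\right)^{16}\left(\sqrt{\frac{3\sqrt{2}+6}{2}}+\sqrt{\frac{3\sqrt{2}+4}{2}}\right)^{8}.$$
   Context: For a positive real $r$, the singular modulus $\alpha_r\in(0,1)$ is the unique number with $\dfrac{{}_2F_1(1/2,1/2;1;1-\alpha_r)}{{}_2F_1(1/2,1/2;1;\alpha_r)}=\sqrt{r}$, where ${}_2F_1$ is the Gaussian hypergeometric function. *)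

theory Defs
  imports "HOL-Analysis.Analysis"
begin

text \<open>
  The value of the Gauss series, the sum of \<open>(a)\<^sub>n (b)\<^sub>n / ((c)\<^sub>n n!) x^n\<close>. This is the Gaussian
  hypergeometric function only for \<open>\<bar>x\<bar> < 1\<close>; no analytic continuation is built in.
\<close>
definition hypergeo_2F1 :: "real \<Rightarrow> real \<Rightarrow> real \<Rightarrow> real \<Rightarrow> real" where
  "hypergeo_2F1 a b c x = eval_fps (fps_hypergeo [a, b] [c] 1) x"

text \<open>
  Meaningful for \<open>r > 0\<close> only: the quotient below then decreases strictly from \<open>\<infinity>\<close> to \<open>0\<close> as
  \<open>\<alpha>\<close> runs through \<open>(0, 1)\<close>, so \<open>\<alpha>\<close> exists and is unique.
\<close>
definition singular_modulus :: "real \<Rightarrow> real" where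
  "singular_modulus r =
    (THE \<alpha>. 0 < \<alpha> \<and> \<alpha> < 1 \<and>
      hypergeo_2F1 (1/2) (1/2) 1 (1 - \<alpha>) / hypergeo_2F1 (1/2) (1/2) 1 \<alpha> = sqrt r)"

end

theory Submission
  imports Defs
begin

text \<open>
  With \<open>a\<close> and \<open>b\<close> the two differences of square roots, the claim is \<open>\<alpha>\<^sub>7\<^sub>2 = a^16 b^8\<close> and
  \<open>\<alpha>\<^sub>8\<^sub>/\<^sub>9 = a^16 / b^8\<close>. The self-reciprocal case of the Landen transformation gives
  \<open>\<alpha>\<^sub>2 = (\<surd>2 - 1)^2\<close>, and Landen with \<open>p = a^4\<close> gives \<open>\<alpha>\<^sub>8 = a^8\<close>. Ramanujan's cubic transformation
  triples the ratio of periods from \<open>p (2 + p)^3 / (1 + 2p)^3\<close> to \<open>p^3 (2 + p) / (1 + 2p)\<close>. Its parameter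
  \<open>p = a^5 b^3\<close> has first value \<open>a^8\<close> and leads up to \<open>\<alpha>\<^sub>7\<^sub>2\<close>; \<open>p = a b\<close> has second value \<open>a^8\<close> and
  leads down to \<open>\<alpha>\<^sub>8\<^sub>/\<^sub>9\<close>.
\<close>

section \<open>The series \<open>F\<close> and its differential equation\<close>

abbreviation F :: "real \<Rightarrow> real" where
  "F \<equiv> hypergeo_2F1 (1/2) (1/2) 1"

abbreviation F_fps :: "real fps" where
  "F_fps \<equiv> fps_hypergeo [1/2, 1/2] [1] 1"

lemma F_fps_nth_Suc:
  "fps_nth F_fps (Suc n) = ((1/2 + real n) / (1 + real n))^2 * fps_nth F_fps n"
  unfolding fps_hypergeo_rec by (simp add: power2_eq_square algebra_simps)

lemma F_fps_nth_pos: "fps_nth F_fps n > 0"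
  by (simp add: pochhammer_pos)

lemma F_fps_nth_le_1: "fps_nth F_fps n \<le> 1"
proof (induction n)
  case 0
  show ?case by (subst fps_hypergeo_0) simp
next
  case (Suc n)
  have "((1/2 + real n) / (1 + real n))^2 \<le> 1"
    by (simp add: power_le_one)
  then show ?case
    unfolding F_fps_nth_Suc using Suc F_fps_nth_pos[of n] by (intro mult_le_one) auto
qed

text \<open>All coefficients lie in \<open>(0, 1]\<close>, so the geometric series
  dominates.\<close>

lemma F_fps_conv_radius: "fps_conv_radius F_fps \<ge> 1"
  unfolding fps_conv_radius_def
proof (rule conv_radius_geI_ex')
  fix r :: real assume r: "0 < r" "ereal r < 1"
  show "summable (\<lambda>n. fps_nth F_fps n * of_real r ^ n)"
  proof (rule summable_comparison_test')
    show "summable (\<lambda>n. r ^ n)" using r by (simp add: summable_geometric)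
    show "norm (fps_nth F_fps n * of_real r ^ n) \<le> r ^ n" if "n \<ge> 0" for n
    proof -
      have "\<bar>fps_nth F_fps n\<bar> \<le> 1"
        using F_fps_nth_pos[of n] F_fps_nth_le_1[of n] by linarith
      then have "\<bar>fps_nth F_fps n\<bar> * r ^ n \<le> 1 * r ^ n"
        using r by (intro mult_right_mono) auto
      then show ?thesis using r by (simp add: abs_mult del: fps_hypergeo_nth)
    qed
  qed
qed

text \<open>This is the hypergeometric equation in self-adjoint form,
  \<open>(x (1 - x) y')' = y / 4\<close>. On coefficients it reduces to the recurrence, because
  \<open>(n + 1/2)^2 - n (n + 1) = 1/4\<close>.\<close>

lemma F_fps_ode:
  "fps_deriv (fps_X * ((1 - fps_X) * fps_deriv F_fps)) = fps_const (1/4) * F_fps"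
proof (rule fps_ext)
  fix n
  have rec: "(1 + real n)\<^sup>2 * fps_nth F_fps (Suc n) = (1/2 + real n)^2 * fps_nth F_fps n"
    unfolding F_fps_nth_Suc by (simp add: power_divide del: fps_hypergeo_nth)
  have "fps_nth (fps_deriv (fps_X * ((1 - fps_X) * fps_deriv F_fps))) n =
      (1 + real n)^2 * fps_nth F_fps (Suc n) - real n * (1 + real n) * fps_nth F_fps n"
    by (cases n) (simp_all add: algebra_simps power2_eq_square del: fps_hypergeo_nth)
  then show "fps_nth (fps_deriv (fps_X * ((1 - fps_X) * fps_deriv F_fps))) n =
      fps_nth (fps_const (1/4) * F_fps) n"
    unfolding rec by (simp add: algebra_simps power2_eq_square del: fps_hypergeo_nth)
qed

lemma less_F_fps_conv_radius: "\<bar>x :: real\<bar> < 1 \<Longrightarrow> ereal (norm x) < fps_conv_radius F_fps"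
  by (rule less_le_trans[OF _ F_fps_conv_radius]) (simp add: one_ereal_def)

lemma F_eq_eval_fps: "F = eval_fps F_fps"
  by (simp add: hypergeo_2F1_def fun_eq_iff)

lemma F_0 [simp]: "F 0 = 1"
  by (simp add: F_eq_eval_fps eval_fps_at_0)

lemma F_has_deriv:
  assumes "\<bar>x\<bar> < 1" shows "(F has_real_derivative deriv F x) (at x)"
  unfolding F_eq_eval_fps
  by (metis DERIV_imp_deriv has_field_derivative_eval_fps less_F_fps_conv_radius[OF assms])

text \<open>Transfers the formal equation to values on \<open>(-1, 1)\<close>. Evaluation commutes
  with products only inside the radii of convergence, so each factor is first shown to have radius
  at least 1.\<close>

lemma F_ode:
  assumes "\<bar>x\<bar> < 1"
  shows "((\<lambda>x. x * (1 - x) * deriv F x) has_real_derivative F x / 4) (at x)"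
proof -
  let ?D = "fps_deriv F_fps" and ?A = "fps_X * ((1 - fps_X) * fps_deriv F_fps)"
  have rD: "fps_conv_radius ?D \<ge> 1"
    using F_fps_conv_radius fps_conv_radius_deriv order_trans by blast
  have r1: "fps_conv_radius (1 - fps_X :: real fps) \<ge> 1"
    using fps_conv_radius_diff[of "1 :: real fps" fps_X] by simp
  have rB: "fps_conv_radius ((1 - fps_X) * ?D) \<ge> 1"
    using fps_conv_radius_mult[of "1 - fps_X" ?D] rD r1 by (meson min.boundedI order_trans)
  have rA: "fps_conv_radius ?A \<ge> 1"
    using fps_conv_radius_mult[of fps_X "(1 - fps_X) * ?D"] rB
    by (simp add: min_def split: if_splits)
  have in_radius: "ereal (norm y) < fps_conv_radius f"
    if "\<bar>y\<bar> < 1" "fps_conv_radius f \<ge> 1" for f :: "real fps" and y :: real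
    by (rule less_le_trans[OF _ that(2)]) (use that(1) in \<open>simp add: one_ereal_def\<close>)
  have eval: "eval_fps ?A y = y * (1 - y) * deriv F y" if y: "\<bar>y\<bar> < 1" for y
  proof -
    have "eval_fps ?A y = y * eval_fps ((1 - fps_X) * ?D) y"
      using in_radius[OF y rB] by (simp add: eval_fps_mult)
    also have "\<dots> = y * ((1 - y) * eval_fps ?D y)"
      using in_radius[OF y rD] in_radius[OF y r1] by (simp add: eval_fps_mult eval_fps_diff)
    also have "eval_fps ?D y = deriv F y"
      unfolding F_eq_eval_fps by (intro eval_fps_deriv less_F_fps_conv_radius y)
    finally show ?thesis by simp
  qed
  have "(eval_fps ?A has_real_derivative eval_fps (fps_deriv ?A) x) (at x)"
    by (intro has_field_derivative_eval_fps in_radius rA assms)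
  also have "eval_fps (fps_deriv ?A) x = F x / 4"
    unfolding F_fps_ode F_eq_eval_fps
    using less_F_fps_conv_radius[OF assms] by (subst eval_fps_mult) simp_all
  finally show ?thesis
    by (rule has_field_derivative_transform_within_open[where S = "{-1<..<1}"])
      (use assms eval in auto)
qed

section \<open>Monotonicity, the period ratio and uniqueness of singular moduli\<close>

lemma F_pos:
  assumes "0 \<le> x" "x < 1" shows "F x > 0"
  unfolding F_eq_eval_fps eval_fps_def
proof (rule suminf_pos2[where i = 0])
  show "summable (\<lambda>n. fps_nth F_fps n * x ^ n)"
    using assms by (intro summable_fps less_F_fps_conv_radius) simp
  show "0 \<le> fps_nth F_fps n * x ^ n" for n
    using assms F_fps_nth_pos[of n] by (intro mult_nonneg_nonneg) auto
  show "0 < fps_nth F_fps 0 * x ^ 0"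
    using F_fps_nth_pos[of 0] by simp
qed

text \<open>By the differential equation \<open>x (1 - x) F'\<close> has derivative
  \<open>F / 4 > 0\<close>, and it vanishes at 0.\<close>

lemma deriv_F_pos:
  assumes "0 < x" "x < 1" shows "deriv F x > 0"
proof -
  have "0 * (1 - 0) * deriv F 0 < x * (1 - x) * deriv F x"
  proof (rule DERIV_pos_imp_increasing[where f = "\<lambda>x. x * (1 - x) * deriv F x", OF assms(1)])
    fix y assume "0 \<le> y" "y \<le> x"
    then show "\<exists>d. ((\<lambda>x. x * (1 - x) * deriv F x) has_real_derivative d) (at y) \<and> 0 < d"
      using F_ode[of y] F_pos[of y] assms by auto
  qed
  moreover have "x * (1 - x) > 0" using assms by simp
  ultimately show ?thesis by (metis mult_zero_left zero_less_mult_pos)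
qed

lemma F_strict_mono:
  assumes "0 < x" "x < y" "y < 1" shows "F x < F y"
  by (rule DERIV_pos_imp_increasing[OF assms(2)])
    (use assms F_has_deriv deriv_F_pos in fastforce)

text \<open>In terms of complete elliptic integrals this is \<open>K'/K\<close> at the modulus
  \<open>k\<close> with \<open>k^2 = x\<close>, as \<open>K = pi/2 * F (k^2)\<close>.\<close>

definition period_ratio :: "real \<Rightarrow> real" where
  "period_ratio x = F (1 - x) / F x"

lemma period_ratio_strict_antimono:
  assumes "0 < x" "x < y" "y < 1" shows "period_ratio y < period_ratio x"
  unfolding period_ratio_def
  using assms F_strict_mono[of x y] F_strict_mono[of "1 - y" "1 - x"] F_pos[of x] F_pos[of y]
    F_pos[of "1 - y"]
  by (intro frac_less) auto

text \<open>The point \<open>x\<close> itself supplies existence; uniqueness is the strict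
  monotonicity of the ratio.\<close>

lemma singular_modulus_eqI:
  assumes "0 < x" "x < 1" "period_ratio x = sqrt r"
  shows "singular_modulus r = x"
  unfolding singular_modulus_def
proof (rule the_equality)
  show "0 < x \<and> x < 1 \<and> F (1 - x) / F x = sqrt r"
    using assms by (simp add: period_ratio_def)
  show "y = x" if "0 < y \<and> y < 1 \<and> F (1 - y) / F y = sqrt r" for y
    using that assms period_ratio_strict_antimono[of x y] period_ratio_strict_antimono[of y x]
    by (cases x y rule: linorder_cases) (auto simp: period_ratio_def)
qed

section \<open>Transformations of \<open>F\<close> of degrees 2 and 3\<close>

text \<open>
  Both sides satisfy the same second-order equation, which is regular singular at \<open>0\<close>. Their
  Wronskian \<open>W\<close>, weighted by \<open>P\<close>, is constant and vanishes at \<open>0\<close>.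
\<close>
lemma F_transformation:
  fixes \<alpha> \<beta> \<alpha>' \<beta>' P P' :: "real \<Rightarrow> real" and c n q :: real
  defines "m \<equiv> \<lambda>p. 1 + c * p"
  assumes "c \<ge> 0" "0 \<le> q"
    and range: "\<And>p. 0 \<le> p \<Longrightarrow> p \<le> q \<Longrightarrow> 0 \<le> \<alpha> p \<and> \<alpha> p < 1 \<and> 0 \<le> \<beta> p \<and> \<beta> p < 1"
    and zero: "\<alpha> 0 = 0" "\<beta> 0 = 0" "P 0 = 0"
    and P_pos: "\<And>p. 0 < p \<Longrightarrow> p \<le> q \<Longrightarrow> P p > 0"
    and \<alpha>: "\<And>p. 0 \<le> p \<Longrightarrow> p \<le> q \<Longrightarrow> (\<alpha> has_real_derivative \<alpha>' p) (at p)"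
    and \<beta>: "\<And>p. 0 \<le> p \<Longrightarrow> p \<le> q \<Longrightarrow> (\<beta> has_real_derivative \<beta>' p) (at p)"
    and P: "\<And>p. 0 \<le> p \<Longrightarrow> p \<le> q \<Longrightarrow> (P has_real_derivative P' p) (at p)"
    and P_\<alpha>: "\<And>p. 0 \<le> p \<Longrightarrow> p \<le> q \<Longrightarrow> P p * \<alpha>' p = \<alpha> p * (1 - \<alpha> p)"
    and P_\<beta>: "\<And>p. 0 \<le> p \<Longrightarrow> p \<le> q \<Longrightarrow> P p * (m p)^2 * \<beta>' p = n * (\<beta> p * (1 - \<beta> p))"
    and ode: "\<And>p. 0 \<le> p \<Longrightarrow> p \<le> q \<Longrightarrow> 4 * c * m p * P' p + n * \<beta>' p = (m p)^2 * \<alpha>' p"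
  shows "F (\<alpha> q) = m q * F (\<beta> q)"
proof (cases "q = 0")
  case True
  then show ?thesis by (simp add: zero m_def)
next
  case False
  then have "q > 0" using \<open>0 \<le> q\<close> by simp
  define A where "A = (\<lambda>x. x * (1 - x) * deriv F x)"
  \<comment> \<open>With \<open>y1 = F (\<alpha> p)\<close> and
    \<open>y2 = m p * F (\<beta> p)\<close> this is \<open>P (y1 y2' - y2 y1')\<close>. The
    hypotheses \<open>P_\<alpha>\<close> and \<open>P_\<beta>\<close> express \<open>P y1'\<close>
    and \<open>P y2'\<close> through \<open>A\<close>, which \<open>F_ode\<close> differentiates
    without second derivatives of \<open>F\<close>.\<close>
  define W where "W = (\<lambda>p. F (\<alpha> p) * (c * P p * F (\<beta> p) + n / m p * A (\<beta> p)) - m p * F (\<beta> p) * A (\<alpha> p))"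
  \<comment> \<open>The quotient \<open>y2 / y1\<close>, whose derivative is
    \<open>W / (P y1^2)\<close> wherever \<open>P\<close> is nonzero.\<close>
  define H where "H = (\<lambda>p. m p * F (\<beta> p) / F (\<alpha> p))"
  have m_pos: "m p > 0" if "0 \<le> p" for p
    using that \<open>c \<ge> 0\<close> by (simp add: m_def add_pos_nonneg)
  have m: "(m has_real_derivative c) (at p)" for p
    unfolding m_def by (auto intro!: derivative_eq_intros)
  have A: "(A has_real_derivative F x / 4) (at x)" if "\<bar>x\<bar> < 1" for x
    unfolding A_def using that by (rule F_ode)
  have F\<alpha>: "((\<lambda>p. F (\<alpha> p)) has_real_derivative deriv F (\<alpha> p) * \<alpha>' p) (at p)"
    and F\<beta>: "((\<lambda>p. F (\<beta> p)) has_real_derivative deriv F (\<beta> p) * \<beta>' p) (at p)"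
    and A\<alpha>: "((\<lambda>p. A (\<alpha> p)) has_real_derivative F (\<alpha> p) / 4 * \<alpha>' p) (at p)"
    and A\<beta>: "((\<lambda>p. A (\<beta> p)) has_real_derivative F (\<beta> p) / 4 * \<beta>' p) (at p)"
    if p: "0 \<le> p" "p \<le> q" for p
  proof -
    have "\<bar>\<alpha> p\<bar> < 1" "\<bar>\<beta> p\<bar> < 1" using range[OF p] by auto
    note 1 = DERIV_chain2[OF F_has_deriv[OF this(1)] \<alpha>[OF p]]
      DERIV_chain2[OF F_has_deriv[OF this(2)] \<beta>[OF p]]
      DERIV_chain2[OF A[OF this(1)] \<alpha>[OF p]]
      DERIV_chain2[OF A[OF this(2)] \<beta>[OF p]]
    show "((\<lambda>p. F (\<alpha> p)) has_real_derivative deriv F (\<alpha> p) * \<alpha>' p) (at p)"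
      "((\<lambda>p. F (\<beta> p)) has_real_derivative deriv F (\<beta> p) * \<beta>' p) (at p)"
      "((\<lambda>p. A (\<alpha> p)) has_real_derivative F (\<alpha> p) / 4 * \<alpha>' p) (at p)"
      "((\<lambda>p. A (\<beta> p)) has_real_derivative F (\<beta> p) / 4 * \<beta>' p) (at p)"
      by (fact 1)+
  qed
  have dW: "(W has_real_derivative 0) (at p)" if p: "0 \<le> p" "p \<le> q" for p
  proof -
    define k' where "k' = - n * c / (m p)^2"
    have mp: "m p \<noteq> 0" using m_pos[of p] p by simp
    have k: "((\<lambda>p. n / m p) has_real_derivative k') (at p)"
      unfolding k'_def using mp by (auto intro!: derivative_eq_intros m simp: power2_eq_square)
    have A\<alpha>_eq: "A (\<alpha> p) = P p * \<alpha>' p * deriv F (\<alpha> p)"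
      unfolding A_def P_\<alpha>[OF p] by simp
    have A\<beta>_eq: "n * A (\<beta> p) = P p * (m p)^2 * \<beta>' p * deriv F (\<beta> p)"
      unfolding A_def P_\<beta>[OF p] by simp
    have kA: "n / m p * A (\<beta> p) = P p * m p * \<beta>' p * deriv F (\<beta> p)"
      using A\<beta>_eq mp by (simp add: power2_eq_square divide_eq_eq)
    have "k' * A (\<beta> p) = - c * (n * A (\<beta> p)) / (m p)^2"
      by (simp add: k'_def)
    also have "\<dots> = - c * P p * \<beta>' p * deriv F (\<beta> p)"
      unfolding A\<beta>_eq using mp by (simp add: divide_eq_eq)
    finally have k'A: "k' * A (\<beta> p) = - c * P p * \<beta>' p * deriv F (\<beta> p)" .
    \<comment> \<open>Dividing \<open>ode\<close> by \<open>4 m\<close> gives the relation that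
      makes \<open>y2\<close> satisfy \<open>(P y')' = \<alpha>' y / 4\<close>, the equation of
      \<open>y1\<close>.\<close>
    have "m p * (n / m p * \<beta>' p) = m p * (m p * \<alpha>' p - 4 * c * P' p)"
      using ode[OF p] mp by (simp add: algebra_simps power2_eq_square)
    then have "n / m p * \<beta>' p = m p * \<alpha>' p - 4 * c * P' p"
      using mp by (simp only: mult_cancel_left) simp
    then have k\<beta>: "n / m p * \<beta>' p / 4 = m p * \<alpha>' p / 4 - c * P' p"
      by simp
    let ?D = "deriv F (\<alpha> p) * \<alpha>' p * (c * P p * F (\<beta> p) + n / m p * A (\<beta> p))
       + F (\<alpha> p) * (c * P' p * F (\<beta> p) + c * P p * (deriv F (\<beta> p) * \<beta>' p)
          + k' * A (\<beta> p) + n / m p * \<beta>' p / 4 * F (\<beta> p))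
       - (c * F (\<beta> p) * A (\<alpha> p) + m p * (deriv F (\<beta> p) * \<beta>' p) * A (\<alpha> p)
          + m p * F (\<beta> p) * (F (\<alpha> p) / 4 * \<alpha>' p))"
    note DERIV_diff[OF DERIV_mult[OF F\<alpha>[OF p] DERIV_add[OF
        DERIV_mult[OF DERIV_cmult[OF P[OF p], of c] F\<beta>[OF p]] DERIV_mult[OF k A\<beta>[OF p]]]]
        DERIV_mult[OF DERIV_mult[OF m F\<beta>[OF p]] A\<alpha>[OF p]]]
    then have "(W has_real_derivative ?D) (at p)"
      unfolding W_def by (rule DERIV_cong) (simp add: algebra_simps)
    also have "?D = 0"
      unfolding kA k'A k\<beta> A\<alpha>_eq by (simp add: algebra_simps)
    finally show ?thesis .
  qed
  have W_0: "W p = 0" if p: "0 \<le> p" "p \<le> q" for p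
  proof -
    have "continuous_on {0..q} W"
      by (rule DERIV_continuous_on[where D = "\<lambda>_. 0"])
        (use dW in \<open>simp add: has_field_derivative_at_within\<close>)
    then have "W p = W 0"
      using p \<open>q > 0\<close> dW by (intro DERIV_isconst2[of 0 q W p]) simp_all
    also have "\<dots> = 0" by (simp add: W_def zero A_def)
    finally show ?thesis .
  qed
  have dH: "(H has_real_derivative
      (c * F (\<beta> p) + m p * (deriv F (\<beta> p) * \<beta>' p)) / F (\<alpha> p)
      - m p * F (\<beta> p) * (deriv F (\<alpha> p) * \<alpha>' p) / (F (\<alpha> p))^2) (at p)"
    if p: "0 \<le> p" "p \<le> q" for p
    unfolding H_def using F_pos[of "\<alpha> p"] range[OF p]
    by (auto intro!: derivative_eq_intros F\<alpha>[OF p] F\<beta>[OF p] m simp: field_simps power2_eq_square)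
  \<comment> \<open>At 0 the weight \<open>P\<close> vanishes and \<open>W = 0\<close> says nothing
    about \<open>H'\<close>. Hence the open interval; continuity of \<open>H\<close> covers the end
    points.\<close>
  have dH_0: "(H has_real_derivative 0) (at p)" if p: "0 < p" "p < q" for p
  proof -
    have p': "0 \<le> p" "p \<le> q" using p by auto
    have mp: "m p \<noteq> 0" and Fp: "F (\<alpha> p) \<noteq> 0" and Pp: "P p \<noteq> 0"
      using m_pos[of p] F_pos[of "\<alpha> p"] range[OF p'] P_pos[of p] p by auto
    have A\<alpha>_eq: "A (\<alpha> p) = P p * \<alpha>' p * deriv F (\<alpha> p)"
      unfolding A_def P_\<alpha>[OF p'] by simp
    have A\<beta>_eq: "n / m p * A (\<beta> p) = P p * m p * \<beta>' p * deriv F (\<beta> p)"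
    proof -
      have "n * A (\<beta> p) = P p * (m p)^2 * \<beta>' p * deriv F (\<beta> p)"
        unfolding A_def P_\<beta>[OF p'] by simp
      then show ?thesis using mp by (simp add: power2_eq_square divide_eq_eq)
    qed
    have "P p * (F (\<alpha> p) * (c * F (\<beta> p) + m p * (deriv F (\<beta> p) * \<beta>' p))
         - m p * F (\<beta> p) * (deriv F (\<alpha> p) * \<alpha>' p)) = W p"
      unfolding W_def A\<alpha>_eq A\<beta>_eq by (simp add: algebra_simps)
    then have "F (\<alpha> p) * (c * F (\<beta> p) + m p * (deriv F (\<beta> p) * \<beta>' p))
         = m p * F (\<beta> p) * (deriv F (\<alpha> p) * \<alpha>' p)"
      using W_0[OF p'] Pp by simp
    then show ?thesis
      using dH[OF p'] Fp by (simp add: field_simps power2_eq_square)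
  qed
  have "continuous_on {0..q} H"
    by (rule DERIV_continuous_on, rule has_field_derivative_at_within, rule dH) simp_all
  then have "H q = H 0"
    using \<open>q > 0\<close> dH_0 by (intro DERIV_isconst_end) simp_all
  also have "\<dots> = 1" by (simp add: H_def m_def zero)
  finally show ?thesis
    using F_pos[of "\<alpha> q"] range[of q] \<open>q > 0\<close> by (simp add: H_def field_simps)
qed

text \<open>The case \<open>c = 1\<close>, \<open>n = 2\<close> of \<open>F_transformation\<close>.
  The weight \<open>P\<close> is forced to be \<open>\<alpha> (1 - \<alpha>) / \<alpha>'\<close>;
  the equations to check are then identities between rational functions of \<open>p\<close>.\<close>

lemma F_landen:
  assumes q: "0 \<le> q" "q < 1"
  shows "F (4 * q / (1 + q)^2) = (1 + q) * F (q^2)"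
proof -
  have "F (4 * q / (1 + q)^2) = (1 + 1 * q) * F (q^2)"
  proof (rule F_transformation[where n = 2 and \<alpha>' = "\<lambda>p. 4 * (1 - p) / (1 + p)^3" and \<beta>' = "\<lambda>p. 2 * p"
        and P = "\<lambda>p. p * (1 - p) / (1 + p)" and P' = "\<lambda>p. (1 - 2*p - p^2) / (1 + p)^2"])
    fix p assume p: "0 \<le> p" "p \<le> q"
    then have p1: "p < 1" and nz: "1 + p \<noteq> 0" using q by auto
    have co: "1 - 4 * p / (1 + p)^2 = (1 - p)^2 / (1 + p)^2"
      using nz by (simp add: divide_simps) (simp add: algebra_simps power2_eq_square)
    have "(1 - p)^2 / (1 + p)^2 > 0" using p1 nz by simp
    with co have "4 * p / (1 + p)^2 < 1" by linarith
    then show "0 \<le> 4 * p / (1 + p)^2 \<and> 4 * p / (1 + p)^2 < 1 \<and> 0 \<le> p^2 \<and> p^2 < 1"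
      using p p1 by (simp add: power_less_one_iff)
    show "((\<lambda>p. 4 * p / (1 + p)^2) has_real_derivative 4 * (1 - p) / (1 + p)^3) (at p)"
      using nz by (auto intro!: derivative_eq_intros simp: divide_simps power_eq_if) (simp add: algebra_simps)
    show "((\<lambda>p. p^2) has_real_derivative 2 * p) (at p)"
      by (auto intro!: derivative_eq_intros)
    show "((\<lambda>p. p * (1 - p) / (1 + p)) has_real_derivative (1 - 2*p - p^2) / (1 + p)^2) (at p)"
      using nz by (auto intro!: derivative_eq_intros simp: divide_simps power_eq_if) (simp add: algebra_simps)
    show "p * (1 - p) / (1 + p) * (4 * (1 - p) / (1 + p)^3) = 4 * p / (1 + p)^2 * (1 - 4 * p / (1 + p)^2)"
      unfolding co using nz by (simp add: divide_simps power_eq_if)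
    show "p * (1 - p) / (1 + p) * (1 + 1 * p)^2 * (2 * p) = 2 * (p^2 * (1 - p^2))"
      using nz by (simp add: divide_simps power_eq_if) (simp add: algebra_simps)
    show "4 * 1 * (1 + 1 * p) * ((1 - 2*p - p^2) / (1 + p)^2) + 2 * (2 * p) = (1 + 1 * p)^2 * (4 * (1 - p) / (1 + p)^3)"
      using nz by (simp add: divide_simps power_eq_if) (simp add: algebra_simps)
  qed (use q in \<open>auto simp: add_pos_pos\<close>)
  then show ?thesis by simp
qed

text \<open>The factored complements yield the bounds by 1 and let the two equations for the weight
  in \<open>F_cubic\<close> cancel factor by factor.\<close>

lemma cubic_complements:
  fixes p :: real
  assumes "1 + 2*p \<noteq> 0"
  shows "1 - p * (2 + p)^3 / (1 + 2*p)^3 = (1 + p) * (1 - p)^3 / (1 + 2*p)^3"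
    and "1 - p^3 * (2 + p) / (1 + 2*p) = (1 + p)^3 * (1 - p) / (1 + 2*p)"
  using assms by (simp_all add: divide_simps power_eq_if) (simp_all add: algebra_simps)

lemma cubic_less_1:
  fixes p :: real
  assumes "0 \<le> p" "p < 1"
  shows "p * (2 + p)^3 / (1 + 2*p)^3 < 1" and "p^3 * (2 + p) / (1 + 2*p) < 1"
proof -
  have "(1 + p) * (1 - p)^3 / (1 + 2*p)^3 > 0" "(1 + p)^3 * (1 - p) / (1 + 2*p) > 0"
    using assms by simp_all
  with cubic_complements[of p] assms
  show "p * (2 + p)^3 / (1 + 2*p)^3 < 1" "p^3 * (2 + p) / (1 + 2*p) < 1" by linarith+
qed

text \<open>The case \<open>c = 2\<close>, \<open>n = 3\<close> of \<open>F_transformation\<close>,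
  again with \<open>P = \<alpha> (1 - \<alpha>) / \<alpha>'\<close>. It is Ramanujan's cubic
  transformation in rational parametrization.\<close>

lemma F_cubic:
  assumes q: "0 \<le> q" "q < 1"
  shows "F (q * (2 + q)^3 / (1 + 2*q)^3) = (1 + 2*q) * F (q^3 * (2 + q) / (1 + 2*q))"
proof (rule F_transformation[where n = 3 and \<alpha>' = "\<lambda>p. 2 * (1 - p)^2 * (2 + p)^2 / (1 + 2*p)^4"
      and \<beta>' = "\<lambda>p. 6 * p^2 * (1 + p)^2 / (1 + 2*p)^2"
      and P = "\<lambda>p. p * (2 + p) * (1 + p) * (1 - p) / (2 * (1 + 2*p)^2)"
      and P' = "\<lambda>p. (1 - p - 3*p^2 - 4*p^3 - 2*p^4) / (1 + 2*p)^3"])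
  fix p assume p: "0 \<le> p" "p \<le> q"
  then have p1: "p < 1" and nz: "1 + 2*p \<noteq> 0" using q by auto
  have co\<alpha>: "1 - p * (2 + p)^3 / (1 + 2*p)^3 = (1 + p) * (1 - p)^3 / (1 + 2*p)^3"
    and co\<beta>: "1 - p^3 * (2 + p) / (1 + 2*p) = (1 + p)^3 * (1 - p) / (1 + 2*p)"
    using cubic_complements nz by auto
  have "p * (2 + p)^3 / (1 + 2*p)^3 < 1" "p^3 * (2 + p) / (1 + 2*p) < 1"
    using cubic_less_1 p p1 by auto
  then show "0 \<le> p * (2 + p)^3 / (1 + 2*p)^3 \<and> p * (2 + p)^3 / (1 + 2*p)^3 < 1 \<and>
      0 \<le> p^3 * (2 + p) / (1 + 2*p) \<and> p^3 * (2 + p) / (1 + 2*p) < 1"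
    using p by simp
  show "((\<lambda>p. p * (2 + p)^3 / (1 + 2*p)^3) has_real_derivative 2 * (1 - p)^2 * (2 + p)^2 / (1 + 2*p)^4) (at p)"
    using nz by (auto intro!: derivative_eq_intros simp: divide_simps power_eq_if) (simp add: algebra_simps)
  show "((\<lambda>p. p^3 * (2 + p) / (1 + 2*p)) has_real_derivative 6 * p^2 * (1 + p)^2 / (1 + 2*p)^2) (at p)"
    using nz by (auto intro!: derivative_eq_intros simp: divide_simps power_eq_if) (simp add: algebra_simps)
  show "((\<lambda>p. p * (2 + p) * (1 + p) * (1 - p) / (2 * (1 + 2*p)^2)) has_real_derivative
      (1 - p - 3*p^2 - 4*p^3 - 2*p^4) / (1 + 2*p)^3) (at p)"
    using nz by (auto intro!: derivative_eq_intros simp: divide_simps power_eq_if) (simp add: algebra_simps)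
  show "p * (2 + p) * (1 + p) * (1 - p) / (2 * (1 + 2*p)^2) * (2 * (1 - p)^2 * (2 + p)^2 / (1 + 2*p)^4)
      = p * (2 + p)^3 / (1 + 2*p)^3 * (1 - p * (2 + p)^3 / (1 + 2*p)^3)"
    unfolding co\<alpha> using nz by (simp add: divide_simps power_eq_if)
  show "p * (2 + p) * (1 + p) * (1 - p) / (2 * (1 + 2*p)^2) * (1 + 2*p)^2 * (6 * p^2 * (1 + p)^2 / (1 + 2*p)^2)
      = 3 * (p^3 * (2 + p) / (1 + 2*p) * (1 - p^3 * (2 + p) / (1 + 2*p)))"
    unfolding co\<beta> using nz by (simp add: divide_simps power_eq_if)
  show "4 * 2 * (1 + 2*p) * ((1 - p - 3*p^2 - 4*p^3 - 2*p^4) / (1 + 2*p)^3) + 3 * (6 * p^2 * (1 + p)^2 / (1 + 2*p)^2)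
      = (1 + 2*p)^2 * (2 * (1 - p)^2 * (2 + p)^2 / (1 + 2*p)^4)"
    using nz by (simp add: divide_simps power_eq_if) (simp add: algebra_simps)
qed (use q in \<open>auto simp: add_pos_pos\<close>)

section \<open>Multiplication of the period ratio by 2 and by 3\<close>

text \<open>The involution \<open>p \<mapsto> (1 - p) / (1 + p)\<close> exchanges each modulus with the complement of the other.\<close>
lemma period_ratio_landen:
  assumes p: "0 < p" "p < 1"
  shows "period_ratio (p^2) = 2 * period_ratio (4 * p / (1 + p)^2)"
proof -
  define p' where "p' = (1 - p) / (1 + p)"
  have p': "0 < p'" "p' < 1" using p by (auto simp: p'_def)
  \<comment> \<open>The multipliers \<open>1 + p\<close> and \<open>1 + p'\<close> have product 2,
    which is the factor in the conclusion.\<close>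
  have m': "1 + p' = 2 / (1 + p)" using p by (simp add: p'_def field_simps)
  have \<alpha>': "4 * p' / (1 + p')^2 = 1 - p^2"
    unfolding m' unfolding p'_def using p by (simp add: divide_simps power2_eq_square) (simp add: algebra_simps)
  have \<beta>': "p'^2 = 1 - 4 * p / (1 + p)^2"
    unfolding p'_def using p by (simp add: divide_simps power2_eq_square) (simp add: algebra_simps)
  have "F (p^2) > 0"
    using p by (intro F_pos) (auto simp: power_less_one_iff)
  moreover have "F (1 - p^2) = (2 / (1 + p)) * F (1 - 4 * p / (1 + p)^2)"
    using F_landen[of p'] p' unfolding \<alpha>' \<beta>' unfolding m' by simp
  moreover have "F (4 * p / (1 + p)^2) = (1 + p) * F (p^2)"
    using F_landen[of p] p by simp
  ultimately show ?thesis
    using p by (simp add: period_ratio_def)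
qed

text \<open>Here the involution is \<open>p \<mapsto> (1 - p) / (1 + 2p)\<close>. It too swaps each
  modulus with the complement of the other, and the multipliers \<open>1 + 2p\<close> and
  \<open>1 + 2p'\<close> have product 3.\<close>

lemma period_ratio_cubic:
  assumes p: "0 < p" "p < 1"
  shows "period_ratio (p^3 * (2 + p) / (1 + 2*p)) = 3 * period_ratio (p * (2 + p)^3 / (1 + 2*p)^3)"
proof -
  define p' where "p' = (1 - p) / (1 + 2*p)"
  have p': "0 < p'" "p' < 1" using p by (auto simp: p'_def)
  have m': "1 + 2*p' = 3 / (1 + 2*p)" and t': "2 + p' = 3 * (1 + p) / (1 + 2*p)"
    using p by (simp_all add: p'_def field_simps)
  have \<alpha>': "p' * (2 + p')^3 / (1 + 2*p')^3 = 1 - p^3 * (2 + p) / (1 + 2*p)"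
    unfolding m' t' unfolding p'_def using p by (simp add: divide_simps power_eq_if) (simp add: algebra_simps)
  have \<beta>': "p'^3 * (2 + p') / (1 + 2*p') = 1 - p * (2 + p)^3 / (1 + 2*p)^3"
    unfolding m' t' unfolding p'_def using p by (simp add: divide_simps power_eq_if) (simp add: algebra_simps)
  have "F (p^3 * (2 + p) / (1 + 2*p)) > 0"
    using p cubic_less_1[of p] by (intro F_pos) auto
  moreover have "F (1 - p^3 * (2 + p) / (1 + 2*p)) = (3 / (1 + 2*p)) * F (1 - p * (2 + p)^3 / (1 + 2*p)^3)"
    using F_cubic[of p'] p' unfolding \<alpha>' \<beta>' unfolding m' by simp
  moreover have "F (p * (2 + p)^3 / (1 + 2*p)^3) = (1 + 2*p) * F (p^3 * (2 + p) / (1 + 2*p))"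
    using F_cubic[of p] p by simp
  ultimately show ?thesis
    using p by (simp add: period_ratio_def)
qed

text \<open>The number \<open>sqrt 2 - 1\<close> is the fixed point of the Landen involution, so the
  two moduli are complementary and their ratios reciprocal. Landen then reads
  \<open>\<rho> = 2 / \<rho>\<close> for the ratio \<open>\<rho>\<close>, and positivity selects the
  root.\<close>

lemma period_ratio_alpha_2: "period_ratio ((sqrt 2 - 1)^2) = sqrt 2"
proof -
  define p :: real where "p = sqrt 2 - 1"
  have p: "0 < p" "p < 1" by (auto simp: p_def real_less_lsqrt)
  have "1 - 4 * p / (1 + p)^2 = p^2"
    by (simp add: p_def power2_eq_square field_simps)
  then have 1: "4 * p / (1 + p)^2 = 1 - p^2" by simp
  have p2: "0 < p^2" "p^2 < 1" using p by (auto simp: power_less_one_iff)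
  then have F_p2: "F (p^2) > 0" "F (1 - p^2) > 0" by (auto intro!: F_pos)
  then have "period_ratio (p^2) * period_ratio (1 - p^2) = 1"
    by (simp add: period_ratio_def)
  moreover have "period_ratio (p^2) = 2 * period_ratio (1 - p^2)"
    using period_ratio_landen[OF p] 1 by simp
  ultimately have "(period_ratio (p^2))^2 = 2" by (simp add: power2_eq_square)
  moreover have "period_ratio (p^2) > 0"
    using F_p2 by (simp add: period_ratio_def)
  ultimately show ?thesis
    unfolding p_def[symmetric] by (metis real_sqrt_unique less_imp_le)
qed

section \<open>Evaluation of the two singular moduli\<close>

theorem theorem5p2:
  shows "singular_modulus 72 =
           (sqrt ((sqrt 2 + 2) / 2) - sqrt (sqrt 2 / 2)) ^ 16 *
           (sqrt ((3 * sqrt 2 + 6) / 2) - sqrt ((3 * sqrt 2 + 4) / 2)) ^ 8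
       \<and> singular_modulus (8 / 9) =
           (sqrt ((sqrt 2 + 2) / 2) - sqrt (sqrt 2 / 2)) ^ 16 *
           (sqrt ((3 * sqrt 2 + 6) / 2) + sqrt ((3 * sqrt 2 + 4) / 2)) ^ 8"
proof -
  txt \<open>All numbers lie in \<open>w \<cdot> \<rat>(s, r)\<close> or \<open>\<rat>(s, r)\<close>, whose elements reduce to normal form by
    \<open>s^4 = 2 s^2 + 1\<close> and \<open>r^2 = 3\<close>.\<close>
  define w s r :: real where "w = sqrt (sqrt 2 / 2)" and "s = sqrt (1 + sqrt 2)" and "r = sqrt 3"
  define a b b' :: real where "a = sqrt ((sqrt 2 + 2) / 2) - sqrt (sqrt 2 / 2)"
    and "b = sqrt ((3 * sqrt 2 + 6) / 2) - sqrt ((3 * sqrt 2 + 4) / 2)"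
    and "b' = sqrt ((3 * sqrt 2 + 6) / 2) + sqrt ((3 * sqrt 2 + 4) / 2)"
  have s2: "s^2 = 1 + sqrt 2" and r2: "r^2 = 3" and w2: "w^2 = (s^2 - 1) / 2"
    by (simp_all add: s_def r_def w_def)
  have s4: "s^4 = 2 * s^2 + 1"
  proof -
    have "s^4 = (s^2)^2" by simp
    then show ?thesis unfolding s2 by (simp add: power2_eq_square algebra_simps)
  qed
  \<comment> \<open>Rewrite rules bringing the degree below 4 in \<open>s\<close> and below 2 in
    \<open>r\<close>. Simplification nests products to the right, so each rule has a variant with a
    trailing factor \<open>x\<close>.\<close>
  have reduce: "s * (s * (s * s)) = 2 * (s * s) + 1" "s * (s * (s * (s * x))) = 2 * (s * (s * x)) + x"
    "r * r = 3" "r * (r * x) = 3 * x" for x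
  proof -
    show "s * (s * (s * s)) = 2 * (s * s) + 1" "r * r = 3"
      using s4 r2 by (simp_all add: power_eq_if)
    have "s * (s * (s * (s * x))) = s^4 * x" by (simp add: power_eq_if)
    then show "s * (s * (s * (s * x))) = 2 * (s * (s * x)) + x"
      unfolding s4 by (simp add: power2_eq_square algebra_simps)
    have "r * (r * x) = r^2 * x" by (simp add: power2_eq_square)
    then show "r * (r * x) = 3 * x" unfolding r2 .
  qed
  \<comment> \<open>Rough bounds, just fine enough for \<open>0 < a < 1\<close> and
    \<open>0 < b < 1\<close>; in particular \<open>s < 8/5 < 17/10 < r\<close> makes
    \<open>b\<close> positive.\<close>
  have "sqrt 2 > 5/4" by (rule real_less_rsqrt) (simp add: power2_eq_square)
  have "sqrt 2 < 3/2" by (rule real_less_lsqrt) (auto simp: power2_eq_square)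
  have s_gt: "s > 3/2"
    unfolding s_def by (rule real_less_rsqrt) (use \<open>sqrt 2 > 5/4\<close> in \<open>simp add: power2_eq_square\<close>)
  have s_lt: "s < 8/5"
    unfolding s_def by (rule real_less_lsqrt) (use \<open>sqrt 2 < 3/2\<close> in \<open>simp_all add: power2_eq_square\<close>)
  have r_bounds: "17/10 < r" "r < 9/5"
    unfolding r_def by (rule real_less_rsqrt real_less_lsqrt; simp add: power2_eq_square)+
  have w_pos: "w > 0" and w_lt: "w < 1"
    unfolding w_def using \<open>sqrt 2 < 3/2\<close> by auto
  \<comment> \<open>Every radicand is \<open>sqrt 2 / 2\<close> times \<open>1 + sqrt 2\<close>,
    \<open>3 (1 + sqrt 2)\<close> or \<open>(1 + sqrt 2)^2\<close>, so \<open>w\<close> splits off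
    from each root.\<close>
  have rad1: "sqrt ((sqrt 2 + 2) / 2) = w * s"
    unfolding w_def s_def real_sqrt_mult[symmetric] by (simp add: field_simps)
  have rad2: "sqrt ((3 * sqrt 2 + 6) / 2) = w * r * s"
    unfolding w_def s_def r_def real_sqrt_mult[symmetric] by (simp add: field_simps)
  have rad3: "sqrt ((3 * sqrt 2 + 4) / 2) = w * s^2"
  proof (rule real_sqrt_unique)
    have "(w * s^2)^2 = w^2 * (s^2)^2" by (simp add: power_mult_distrib)
    also have "\<dots> = (3 * sqrt 2 + 4) / 2"
      unfolding w2 s2 by (simp add: field_simps power2_eq_square)
    finally show "(w * s^2)^2 = (3 * sqrt 2 + 4) / 2" .
  qed (use w_pos in auto)
  have a: "a = w * (s - 1)" and b: "b = w * (s * (r - s))" and b': "b' = w * (s * (r + s))"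
    unfolding a_def b_def b'_def rad1 rad2 rad3 w_def[symmetric]
    by (simp_all add: algebra_simps power2_eq_square)
  have a_bounds: "0 < a" "a < 1"
  proof -
    show "0 < a" unfolding a using s_gt w_pos by simp
    have "w * (s - 1) < 1 * 1" using s_gt s_lt w_pos w_lt by (intro mult_strict_mono) auto
    then show "a < 1" unfolding a by simp
  qed
  have b_bounds: "0 < b" "b < 1"
  proof -
    show "0 < b" unfolding b using s_gt s_lt r_bounds w_pos by simp
    have "s * (r - s) < 8/5 * (3/10)" using s_gt s_lt r_bounds by (intro mult_strict_mono) auto
    then have "w * (s * (r - s)) < 1 * 1"
      using s_gt s_lt r_bounds w_pos w_lt by (intro mult_strict_mono) auto
    then show "b < 1" unfolding b by simp
  qed
  \<comment> \<open>The two radicands in \<open>b\<close> and \<open>b'\<close> differ by 1. So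
    \<open>b' = 1 / b\<close>, which turns the second formula into
    \<open>a^16 / b^8\<close>.\<close>
  have bb': "b * b' = 1"
  proof -
    have "b * b' = w^2 * (s^2 * (r^2 - s^2))"
      unfolding b b' by (simp add: algebra_simps power2_eq_square)
    also have "\<dots> = 1"
      unfolding w2 r2 by (simp add: field_simps power_eq_if reduce)
    finally show ?thesis .
  qed
  have X: "a * b = (1 + r - s + r * s + s^2 + r * s^2 - s^3 - r * s^3) / 2"
  proof -
    have "a * b = w^2 * ((s - 1) * (s * (r - s)))"
      unfolding a b by (simp add: power2_eq_square)
    also have "\<dots> = (1 + r - s + r * s + s^2 + r * s^2 - s^3 - r * s^3) / 2"
      unfolding w2 by (simp add: field_simps power_eq_if reduce)
    finally show ?thesis .
  qed
  have a2: "a^2 = s + s^2 - s^3"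
    unfolding a power_mult_distrib w2 by (simp add: field_simps power_eq_if reduce)
  \<comment> \<open>For \<open>p = a^5 b^3\<close> this says
    \<open>(2 + p) / (1 + 2p) = a / b\<close>, so both cubic moduli become monomials:
    \<open>p (a/b)^3 = a^8\<close> and \<open>p^3 (a/b) = a^16 b^8\<close>. The proof divides out
    the common \<open>w\<close> and compares normal forms in \<open>\<rat>(s, r)\<close>, reached by
    successive products.\<close>
  have id\<^sub>1: "b * (2 + a^5 * b^3) = a * (1 + 2 * (a^5 * b^3))"
  proof -
    have X2: "(a * b)^2 = 3 + 2 * r - s - r * s + 8 * s^2 + 4 * r * s^2 - 5 * s^3 - 3 * r * s^3"
      unfolding X by (simp add: field_simps power_eq_if reduce)
    have "(a * b)^3 = (a * b) * (a * b)^2"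
      by (simp add: power_eq_if)
    also have "\<dots> = (57 + 33 * r - 35 * s - 21 * r * s + 137 * s^2 + 81 * r * s^2 - 91 * s^3 - 51 * r * s^3) / 2"
      unfolding X2 unfolding X by (simp add: field_simps power_eq_if reduce)
    finally have X3: "(a * b)^3 = (57 + 33 * r - 35 * s - 21 * r * s + 137 * s^2 + 81 * r * s^2 - 91 * s^3 - 51 * r * s^3) / 2" .
    have "a^5 * b^3 = a^2 * (a * b)^3"
      by (simp add: power_mult_distrib power_eq_if)
    also have "\<dots> = (263 + 153 * r - 171 * s - 99 * r * s + 639 * s^2 + 369 * r * s^2 - 411 * s^3 - 237 * r * s^3) / 2"
      unfolding a2 X3 by (simp add: field_simps power_eq_if reduce)
    finally have Y: "a^5 * b^3 = (263 + 153 * r - 171 * s - 99 * r * s + 639 * s^2 + 369 * r * s^2 - 411 * s^3 - 237 * r * s^3) / 2" .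
    have core: "s * (r - s) * (2 + a^5 * b^3) = (s - 1) * (1 + 2 * (a^5 * b^3))"
      unfolding Y by (simp add: field_simps power_eq_if reduce)
    have "b * (2 + a^5 * b^3) = w * (s * (r - s) * (2 + a^5 * b^3))"
      by (simp only: b mult.assoc)
    also have "\<dots> = a * (1 + 2 * (a^5 * b^3))"
      unfolding core by (simp only: a mult.assoc)
    finally show ?thesis .
  qed
  \<comment> \<open>For \<open>p = a b\<close> this says
    \<open>(2 + p) / (1 + 2p) = a^5 / b^3\<close>, making the cubic moduli \<open>a^16 / b^8\<close>
    and \<open>a^8\<close>. Now the common factor is \<open>w^3\<close>.\<close>
  have id\<^sub>2: "b^3 * (2 + a * b) = a^5 * (1 + 2 * (a * b))"
  proof -
    have v3: "(s * (r - s))^3 = - 11 + 3 * r * s - 23 * s^2 + 9 * r * s^3"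
      by (simp add: field_simps power_eq_if reduce)
    have u5: "w^2 * (s - 1)^5 = - 7 + 3 * s - 13 * s^2 + 9 * s^3"
      unfolding w2 by (simp add: field_simps power_eq_if reduce)
    have core: "(s * (r - s))^3 * (2 + a * b) = w^2 * (s - 1)^5 * (1 + 2 * (a * b))"
      unfolding v3 u5 X by (simp add: field_simps power_eq_if reduce)
    have b3: "b^3 = w^3 * (s * (r - s))^3"
      by (simp only: b power_mult_distrib)
    have a5: "a^5 = w^3 * (w^2 * (s - 1)^5)"
      by (simp add: a power_mult_distrib power_eq_if mult_ac)
    show ?thesis unfolding b3 a5 mult.assoc[of "w^3"] core ..
  qed
  have a8: "period_ratio (a^8) = 2 * sqrt 2"
  proof -
    \<comment> \<open>Landen at \<open>a^4\<close> calls for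
      \<open>4 a^4 / (1 + a^4)^2 = (sqrt 2 - 1)^2\<close>. This is its square root, with
      \<open>s^2 - 2\<close> for \<open>sqrt 2 - 1\<close>.\<close>
    have "2 * a^2 = (s^2 - 2) * (1 + (a^2)^2)"
      unfolding a2 by (simp add: field_simps power_eq_if reduce)
    then have "2 * a^2 = (sqrt 2 - 1) * (1 + a^4)"
      by (simp add: s2)
    moreover have "1 + a^4 \<noteq> 0" using zero_le_power[of a 4] a_bounds by linarith
    ultimately have "2 * a^2 / (1 + a^4) = sqrt 2 - 1"
      by (simp add: nonzero_divide_eq_eq)
    then have "(sqrt 2 - 1)^2 = (2 * a^2 / (1 + a^4))^2" by simp
    also have "\<dots> = 4 * a^4 / (1 + a^4)^2"
      by (simp add: power_divide power_mult_distrib)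
    finally have "4 * a^4 / (1 + a^4)^2 = (sqrt 2 - 1)^2" ..
    then show ?thesis
      using period_ratio_landen[of "a^4"] a_bounds period_ratio_alpha_2
      by (simp add: power_less_one_iff)
  qed
  have "period_ratio (a^16 * b^8) = sqrt 72"
  proof -
    define p where "p = a^5 * b^3"
    have p: "0 < p" "p < 1"
      using a_bounds b_bounds mult_strict_mono[of "a^5" 1 "b^3" 1]
      by (auto simp: p_def power_less_one_iff)
    have quot: "(2 + p) / (1 + 2 * p) = a / b"
      using id\<^sub>1 p b_bounds unfolding p_def[symmetric] by (simp add: field_simps)
    have "p * (2 + p)^3 / (1 + 2*p)^3 = p * (a / b)^3"
      unfolding quot[symmetric] by (simp add: power_divide)
    also have "\<dots> = a^8"
      using b_bounds by (simp add: p_def power_divide flip: power_add)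
    finally have 1: "p * (2 + p)^3 / (1 + 2*p)^3 = a^8" .
    have "p^3 * (2 + p) / (1 + 2*p) = p^3 * (a / b)"
      unfolding quot[symmetric] by simp
    also have "\<dots> = (a^15 * a) * b^9 / b"
      by (simp add: p_def power_mult_distrib)
    also have "\<dots> = a^16 * b^8"
      using b_bounds power_Suc2[of a 15] power_Suc2[of b 8] by simp
    finally have 2: "p^3 * (2 + p) / (1 + 2*p) = a^16 * b^8" .
    have "sqrt 72 = sqrt (6^2 * 2)" by simp
    also have "\<dots> = 6 * sqrt 2" unfolding real_sqrt_mult by simp
    finally show ?thesis
      using period_ratio_cubic[OF p] unfolding 1 2 a8 by simp
  qed
  moreover have "0 < a^16 * b^8" "a^16 * b^8 < 1"
    using a_bounds b_bounds mult_strict_mono[of "a^16" 1 "b^8" 1]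
    by (auto simp: power_less_one_iff)
  ultimately have m72: "singular_modulus 72 = a^16 * b^8"
    by (intro singular_modulus_eqI)
  have m89: "singular_modulus (8/9) = a^16 * b'^8"
  proof -
    define p where "p = a * b"
    have p: "0 < p" "p < 1"
      using a_bounds b_bounds mult_strict_mono[of a 1 b 1] by (auto simp: p_def)
    have b'_inv: "b' = 1 / b" using bb' b_bounds by (simp add: field_simps)
    have quot: "(2 + p) / (1 + 2 * p) = a^5 / b^3"
      using id\<^sub>2 p b_bounds unfolding p_def[symmetric] by (simp add: field_simps)
    have "p * (2 + p)^3 / (1 + 2*p)^3 = p * (a^5 / b^3)^3"
      unfolding quot[symmetric] by (simp add: power_divide)
    also have "\<dots> = (a * a^15) * b / b^9"
      by (simp add: p_def power_divide)
    also have "\<dots> = a^16 * b'^8"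
      using b_bounds power_Suc[of a 15] power_Suc[of b 8] by (simp add: b'_inv power_divide)
    finally have 1: "p * (2 + p)^3 / (1 + 2*p)^3 = a^16 * b'^8" .
    have "p^3 * (2 + p) / (1 + 2*p) = p^3 * (a^5 / b^3)"
      unfolding quot[symmetric] by simp
    also have "\<dots> = a^8"
      using b_bounds by (simp add: p_def power_mult_distrib flip: power_add)
    finally have 2: "p^3 * (2 + p) / (1 + 2*p) = a^8" .
    \<comment> \<open>The tripled ratio is now the known one, \<open>2 sqrt 2\<close> at
      \<open>a^8\<close>, so the ratio sought is a third of it.\<close>
    have "sqrt (8/9) = sqrt ((2/3)^2 * 2)" by (simp add: power2_eq_square)
    also have "\<dots> = 2/3 * sqrt 2" unfolding real_sqrt_mult by simp
    finally have "period_ratio (a^16 * b'^8) = sqrt (8/9)"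
      using period_ratio_cubic[OF p] unfolding 1 2 a8 by simp
    \<comment> \<open>Since \<open>b' > 1\<close>, the bound does not follow factor by factor; it
      holds because the number is a cubic modulus with parameter in \<open>(0, 1)\<close>.\<close>
    moreover have "a^16 * b'^8 < 1"
      using cubic_less_1(1)[of p] p unfolding 1 by simp
    moreover have "a^16 * b'^8 > 0"
      using a_bounds b_bounds by (simp add: b'_inv)
    ultimately show ?thesis by (intro singular_modulus_eqI)
  qed
  show ?thesis
    using m72 m89 unfolding a_def b_def b'_def ..
qed

end
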